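(* Given $(=I^{nG})$, the rules $(\forall E)$ and $(\exists I)$ may be restricted to atomic terms: in the system $S$ obtained from $\mathbf{INF}^{\iota}$ by adding the rule $(=I^{nG})$, whenever there is a deduction of a formula $A$ from open assumptions among $\Gamma$, there is a deduction in $S$ of $A$ from open assumptions among $\Gamma$ in which the instantiating term $t$ in every application of $(\forall E)$ and $(\exists I)$ is atomic.
   Context: **Language.** First-order language with parameters $a,b,\ldots$ (used as free variables, distinct in shape from the bound variables $x,y,z,\ldots$), constants, predicate letters, identity $=$, a one-place existence predicate $\exists!$, the connectives and quantifiers $\bot,\land,\lor,\rightarrow,\exists,\forall$, and the definite description operator $\iota$, which forms from a variable $x$ and a formula $F$ a term $\iota xF$ binding $x$; $\neg A$ is $A\rightarrow\bot$. Terms are parameters and constants (atomic terms) and $\iota$-terms (complex terms). $A_t^x$ is $A$ with $t$ replacing all free occurrences of $x$. **Rules of $\mathbf{INF}^{\iota}$** (natural deduction trees, $[A]$ marks a class of assumptions discharged by the rule, vacuous discharge allowed). $(\land I)$: from $A$, $B$ infer $A\land B$. $(\land E)$: from $A\land B$ infer $A$; from $A\land B$ infer $B$. $(\rightarrow I)$: from a deduction of $B$ from $[A]$ infer $A\rightarrow B$. $(\rightarrow E)$: from $A\rightarrow B$ and $A$ infer $B$. $(\lor I)$: from $A$ infer $A\lor B$; from $B$ infer $A\lor B$. $(\lor E)$: from $A\lor B$, a deduction of $C$ from $[A]$ and a deduction of $C$ from $[B]$ infer $C$. $(\bot E)$: from $\bot$ infer $B$. $(\forall I)$: from a deduction $\Pi$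 of $A_a^x$ from $[\exists!a]$ infer $\forall xA$, where $a$ does not occur in $\forall xA$ nor in undischarged assumptions of $\Pi$ except those in the class of $\exists!a$. $(\forall E)$: from $\forall xA$ and $\exists!t$ infer $A_t^x$. $(\exists I)$: from $A_t^x$ and $\exists!t$ infer $\exists xA$. $(\exists E)$: from $\exists xA$ and a deduction $\Pi$ of $C$ from $[A_a^x],[\exists!a]$ infer $C$, where $a$ does not occur in $C$, in $\exists xA$, nor in undischarged assumptions of $\Pi$ except those in the classes of $A_a^x$ and $\exists!a$. $(=I^n)$: from $\exists!t$ infer $t=t$. $(=E)$: from $t_1=t_2$ and $A_{t_1}^x$ infer $A_{t_2}^x$. $(AD)$: from $Rt_1\ldots t_n$ infer $\exists!t_i$ ($1\le i\le n$), where $R$ is a predicate letter (not $\exists!$) or $=$. $(\iota I)$: from $\exists!t$, a deduction $\Xi$ of $F_a^x$ from $[a=t]$ and a deduction $\Pi$ of $a=t$ from $[F_a^x],[\exists!a]$ infer $\iota xF=t$, where $a$ does not occur in $\iota xF$, in $t$, nor in undischarged assumptions except those in the classes of $a=t$ in $\Xi$ and of $F_a^x$, $\exists!a$ in $\Pi$. $(\iota E_1)$: from $\iota xF=t$ and $u=t$ infer $F_u^x$. $(\iota E_2)$: from $\iota xF=t$, $F_u^x$ and $\exists!u$ infer $u=t$. $(\iota E_3)$: from $\iota xF=t$ infer $\exists!t$. **Rule $(=I^{nG})$**: from $\exists!t$ and a deduction $\Pi$ of $C$ from $[a=t]$ infer $C$, where the parameter $a$ does not occur in $t$, $C$ nor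 in any open assumptions of $\Pi$ other than those in the class of $a=t$. *)

theory Defs
  imports Main
begin

type_synonym par = nat
type_synonym var = nat

datatype ('c, 'r) tm =
    Par par
  | Con 'c
  | Var var
  | Iota var "('c, 'r) fm"
and ('c, 'r) fm =
    Bot
  | Pred 'r "('c, 'r) tm list"
  | Eq "('c, 'r) tm" "('c, 'r) tm"
  | Existent "('c, 'r) tm" \<comment> \<open>the existence predicate of free logic\<close>
  | And "('c, 'r) fm" "('c, 'r) fm"
  | Or "('c, 'r) fm" "('c, 'r) fm"
  | Imp "('c, 'r) fm" "('c, 'r) fm"
  | Exists var "('c, 'r) fm"
  | Forall var "('c, 'r) fm"

text \<open>
  The datatypes contain expressions with free variables, which are needed as bodies of binders.
  The terms and formulas of the language are the expressions without free variables in which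
  every predicate letter has as many arguments as the arity function \<open>ar\<close> prescribes;
  \<open>V\<close> is the set of variables bound from outside.
\<close>

fun wf_tm :: "('r \<Rightarrow> nat) \<Rightarrow> var set \<Rightarrow> ('c, 'r) tm \<Rightarrow> bool"
  and wf_fm :: "('r \<Rightarrow> nat) \<Rightarrow> var set \<Rightarrow> ('c, 'r) fm \<Rightarrow> bool" where
  "wf_tm ar V (Par a) \<longleftrightarrow> True"
| "wf_tm ar V (Con c) \<longleftrightarrow> True"
| "wf_tm ar V (Var x) \<longleftrightarrow> x \<in> V"
| "wf_tm ar V (Iota x F) \<longleftrightarrow> wf_fm ar (insert x V) F"
| "wf_fm ar V Bot \<longleftrightarrow> True"
| "wf_fm ar V (Pred r ts) \<longleftrightarrow> length ts = ar r \<and> (\<forall>t\<in>set ts. wf_tm ar V t)"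
| "wf_fm ar V (Eq s t) \<longleftrightarrow> wf_tm ar V s \<and> wf_tm ar V t"
| "wf_fm ar V (Existent t) \<longleftrightarrow> wf_tm ar V t"
| "wf_fm ar V (And A B) \<longleftrightarrow> wf_fm ar V A \<and> wf_fm ar V B"
| "wf_fm ar V (Or A B) \<longleftrightarrow> wf_fm ar V A \<and> wf_fm ar V B"
| "wf_fm ar V (Imp A B) \<longleftrightarrow> wf_fm ar V A \<and> wf_fm ar V B"
| "wf_fm ar V (Exists x A) \<longleftrightarrow> wf_fm ar (insert x V) A"
| "wf_fm ar V (Forall x A) \<longleftrightarrow> wf_fm ar (insert x V) A"

abbreviation is_formula :: "('r \<Rightarrow> nat) \<Rightarrow> ('c, 'r) fm \<Rightarrow> bool" where
  "is_formula ar \<equiv> wf_fm ar {}"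

fun is_atomic :: "('c, 'r) tm \<Rightarrow> bool" where
  "is_atomic (Par a) \<longleftrightarrow> True"
| "is_atomic (Con c) \<longleftrightarrow> True"
| "is_atomic (Var x) \<longleftrightarrow> False"
| "is_atomic (Iota x F) \<longleftrightarrow> False"

fun params_tm :: "('c, 'r) tm \<Rightarrow> par set"
  and params_fm :: "('c, 'r) fm \<Rightarrow> par set" where
  "params_tm (Par a) = {a}"
| "params_tm (Con c) = {}"
| "params_tm (Var x) = {}"
| "params_tm (Iota x F) = params_fm F"
| "params_fm Bot = {}"
| "params_fm (Pred r ts) = (\<Union>t\<in>set ts. params_tm t)"
| "params_fm (Eq s t) = params_tm s \<union> params_tm t"
| "params_fm (Existent t) = params_tm t"
| "params_fm (And A B) = params_fm A \<union> params_fm B"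
| "params_fm (Or A B) = params_fm A \<union> params_fm B"
| "params_fm (Imp A B) = params_fm A \<union> params_fm B"
| "params_fm (Exists x A) = params_fm A"
| "params_fm (Forall x A) = params_fm A"

text \<open>
  Replacement of the free occurrences of \<open>x\<close> by \<open>u\<close>. It is only used with terms \<open>u\<close> of the
  language; these have no free variables, so no renaming of bound variables is called for.
\<close>

fun subst_tm :: "var \<Rightarrow> ('c, 'r) tm \<Rightarrow> ('c, 'r) tm \<Rightarrow> ('c, 'r) tm"
  and subst_fm :: "var \<Rightarrow> ('c, 'r) tm \<Rightarrow> ('c, 'r) fm \<Rightarrow> ('c, 'r) fm" where
  "subst_tm x u (Par a) = Par a"
| "subst_tm x u (Con c) = Con c"
| "subst_tm x u (Var y) = (if y = x then u else Var y)"
| "subst_tm x u (Iota y F) = Iota y (if y = x then F else subst_fm x u F)"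
| "subst_fm x u Bot = Bot"
| "subst_fm x u (Pred r ts) = Pred r (map (subst_tm x u) ts)"
| "subst_fm x u (Eq s t) = Eq (subst_tm x u s) (subst_tm x u t)"
| "subst_fm x u (Existent t) = Existent (subst_tm x u t)"
| "subst_fm x u (And A B) = And (subst_fm x u A) (subst_fm x u B)"
| "subst_fm x u (Or A B) = Or (subst_fm x u A) (subst_fm x u B)"
| "subst_fm x u (Imp A B) = Imp (subst_fm x u A) (subst_fm x u B)"
| "subst_fm x u (Exists y A) = Exists y (if y = x then A else subst_fm x u A)"
| "subst_fm x u (Forall y A) = Forall y (if y = x then A else subst_fm x u A)"

text \<open>
  An assumption class is a pair of a label and a formula: two occurrences of an assumption
  belong to the same class iff they agree in both. A rule discharging a class carries its label,
  and the discharge is vacuous if the class does not occur in the subdeduction.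
\<close>

type_synonym label = nat
type_synonym ('c, 'r) acls = "label \<times> ('c, 'r) fm"

datatype ('c, 'r) tree =
    Assm label "('c, 'r) fm"
  | AndI "('c, 'r) tree" "('c, 'r) tree"
  | AndE1 "('c, 'r) tree"
  | AndE2 "('c, 'r) tree"
  | ImpI label "('c, 'r) fm" "('c, 'r) tree"
  | ImpE "('c, 'r) tree" "('c, 'r) tree"
  | OrI1 "('c, 'r) fm" "('c, 'r) tree"
  | OrI2 "('c, 'r) fm" "('c, 'r) tree"
  | OrE "('c, 'r) tree" label "('c, 'r) tree" label "('c, 'r) tree"
  | BotE "('c, 'r) fm" "('c, 'r) tree"
  | ForallI var "('c, 'r) fm" par label "('c, 'r) tree"
  | ForallE "('c, 'r) tm" "('c, 'r) tree" "('c, 'r) tree"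
  | ExistsI var "('c, 'r) fm" "('c, 'r) tm" "('c, 'r) tree" "('c, 'r) tree"
  | ExistsE "('c, 'r) tree" par label label "('c, 'r) tree"
  | EqI "('c, 'r) tree"
  | EqE var "('c, 'r) fm" "('c, 'r) tree" "('c, 'r) tree"
  | AD_Pred nat "('c, 'r) tree"
  | AD_Eq1 "('c, 'r) tree"
  | AD_Eq2 "('c, 'r) tree"
  | IotaI var "('c, 'r) fm" par "('c, 'r) tree" label "('c, 'r) tree" label label "('c, 'r) tree"
  | IotaE1 "('c, 'r) tree" "('c, 'r) tree"
  | IotaE2 "('c, 'r) tree" "('c, 'r) tree" "('c, 'r) tree"
  | IotaE3 "('c, 'r) tree"
  | EqIG "('c, 'r) tree" par label "('c, 'r) tree"

definition fresh_in :: "par \<Rightarrow> ('c, 'r) acls set \<Rightarrow> bool" where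
  "fresh_in a \<Delta> \<longleftrightarrow> (\<forall>(n, B) \<in> \<Delta>. a \<notin> params_fm B)"

text \<open>
  \<open>deduction ar D \<Delta> A\<close>: the tree \<open>D\<close> is a deduction with conclusion \<open>A\<close> whose classes of open
  assumptions are exactly those in \<open>\<Delta>\<close>. The last clause is the rule \<open>=I\<^sup>n\<^sup>G\<close>; the others are the
  rules of \<open>INF\<^sup>\<iota>\<close>. Well-formedness is demanded where an expression is not already constrained
  by the premises; it then holds for every formula in the tree.
\<close>

inductive deduction ::
  "('r \<Rightarrow> nat) \<Rightarrow> ('c, 'r) tree \<Rightarrow> ('c, 'r) acls set \<Rightarrow> ('c, 'r) fm \<Rightarrow> bool" for ar where
  Assm: "is_formula ar A \<Longrightarrow> deduction ar (Assm n A) {(n, A)} A"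
| AndI: "deduction ar D1 \<Delta>1 A \<Longrightarrow> deduction ar D2 \<Delta>2 B \<Longrightarrow>
    deduction ar (AndI D1 D2) (\<Delta>1 \<union> \<Delta>2) (And A B)"
| AndE1: "deduction ar D \<Delta> (And A B) \<Longrightarrow> deduction ar (AndE1 D) \<Delta> A"
| AndE2: "deduction ar D \<Delta> (And A B) \<Longrightarrow> deduction ar (AndE2 D) \<Delta> B"
| ImpI: "is_formula ar A \<Longrightarrow> deduction ar D \<Delta> B \<Longrightarrow>
    deduction ar (ImpI n A D) (\<Delta> - {(n, A)}) (Imp A B)"
| ImpE: "deduction ar D1 \<Delta>1 (Imp A B) \<Longrightarrow> deduction ar D2 \<Delta>2 A \<Longrightarrow>
    deduction ar (ImpE D1 D2) (\<Delta>1 \<union> \<Delta>2) B"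
| OrI1: "is_formula ar B \<Longrightarrow> deduction ar D \<Delta> A \<Longrightarrow> deduction ar (OrI1 B D) \<Delta> (Or A B)"
| OrI2: "is_formula ar A \<Longrightarrow> deduction ar D \<Delta> B \<Longrightarrow> deduction ar (OrI2 A D) \<Delta> (Or A B)"
| OrE: "deduction ar D \<Delta> (Or A B) \<Longrightarrow> deduction ar D1 \<Delta>1 C \<Longrightarrow> deduction ar D2 \<Delta>2 C \<Longrightarrow>
    deduction ar (OrE D n1 D1 n2 D2) (\<Delta> \<union> (\<Delta>1 - {(n1, A)}) \<union> (\<Delta>2 - {(n2, B)})) C"
| BotE: "is_formula ar B \<Longrightarrow> deduction ar D \<Delta> Bot \<Longrightarrow> deduction ar (BotE B D) \<Delta> B"
| ForallI: "deduction ar D \<Delta> (subst_fm x (Par a) A) \<Longrightarrow>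
    a \<notin> params_fm (Forall x A) \<Longrightarrow>
    fresh_in a (\<Delta> - {(n, Existent (Par a))}) \<Longrightarrow>
    deduction ar (ForallI x A a n D) (\<Delta> - {(n, Existent (Par a))}) (Forall x A)"
| ForallE: "deduction ar D1 \<Delta>1 (Forall x A) \<Longrightarrow> deduction ar D2 \<Delta>2 (Existent t) \<Longrightarrow>
    deduction ar (ForallE t D1 D2) (\<Delta>1 \<union> \<Delta>2) (subst_fm x t A)"
| ExistsI: "deduction ar D1 \<Delta>1 (subst_fm x t A) \<Longrightarrow> deduction ar D2 \<Delta>2 (Existent t) \<Longrightarrow>
    deduction ar (ExistsI x A t D1 D2) (\<Delta>1 \<union> \<Delta>2) (Exists x A)"
| ExistsE: "deduction ar D1 \<Delta>1 (Exists x A) \<Longrightarrow> deduction ar D2 \<Delta>2 C \<Longrightarrow>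
    a \<notin> params_fm C \<Longrightarrow> a \<notin> params_fm (Exists x A) \<Longrightarrow>
    fresh_in a (\<Delta>2 - {(n, subst_fm x (Par a) A), (m, Existent (Par a))}) \<Longrightarrow>
    deduction ar (ExistsE D1 a n m D2)
      (\<Delta>1 \<union> (\<Delta>2 - {(n, subst_fm x (Par a) A), (m, Existent (Par a))})) C"
| EqI: "deduction ar D \<Delta> (Existent t) \<Longrightarrow> deduction ar (EqI D) \<Delta> (Eq t t)"
| EqE: "deduction ar D1 \<Delta>1 (Eq t1 t2) \<Longrightarrow> deduction ar D2 \<Delta>2 (subst_fm x t1 A) \<Longrightarrow>
    deduction ar (EqE x A D1 D2) (\<Delta>1 \<union> \<Delta>2) (subst_fm x t2 A)"
| AD_Pred: "deduction ar D \<Delta> (Pred r ts) \<Longrightarrow> i < length ts \<Longrightarrow>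
    deduction ar (AD_Pred i D) \<Delta> (Existent (ts ! i))"
| AD_Eq1: "deduction ar D \<Delta> (Eq t1 t2) \<Longrightarrow> deduction ar (AD_Eq1 D) \<Delta> (Existent t1)"
| AD_Eq2: "deduction ar D \<Delta> (Eq t1 t2) \<Longrightarrow> deduction ar (AD_Eq2 D) \<Delta> (Existent t2)"
| IotaI: "deduction ar D0 \<Delta>0 (Existent t) \<Longrightarrow>
    deduction ar D1 \<Delta>1 (subst_fm x (Par a) F) \<Longrightarrow>
    deduction ar D2 \<Delta>2 (Eq (Par a) t) \<Longrightarrow>
    a \<notin> params_tm (Iota x F) \<Longrightarrow> a \<notin> params_tm t \<Longrightarrow>
    fresh_in a (\<Delta>1 - {(n, Eq (Par a) t)}) \<Longrightarrow>
    fresh_in a (\<Delta>2 - {(m, subst_fm x (Par a) F), (k, Existent (Par a))}) \<Longrightarrow>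
    deduction ar (IotaI x F a D0 n D1 m k D2)
      (\<Delta>0 \<union> (\<Delta>1 - {(n, Eq (Par a) t)})
          \<union> (\<Delta>2 - {(m, subst_fm x (Par a) F), (k, Existent (Par a))}))
      (Eq (Iota x F) t)"
| IotaE1: "deduction ar D1 \<Delta>1 (Eq (Iota x F) t) \<Longrightarrow> deduction ar D2 \<Delta>2 (Eq u t) \<Longrightarrow>
    deduction ar (IotaE1 D1 D2) (\<Delta>1 \<union> \<Delta>2) (subst_fm x u F)"
| IotaE2: "deduction ar D1 \<Delta>1 (Eq (Iota x F) t) \<Longrightarrow> deduction ar D2 \<Delta>2 (subst_fm x u F) \<Longrightarrow>
    deduction ar D3 \<Delta>3 (Existent u) \<Longrightarrow>
    deduction ar (IotaE2 D1 D2 D3) (\<Delta>1 \<union> \<Delta>2 \<union> \<Delta>3) (Eq u t)"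
| IotaE3: "deduction ar D \<Delta> (Eq (Iota x F) t) \<Longrightarrow> deduction ar (IotaE3 D) \<Delta> (Existent t)"
| EqIG: "deduction ar D1 \<Delta>1 (Existent t) \<Longrightarrow> deduction ar D2 \<Delta>2 C \<Longrightarrow>
    a \<notin> params_tm t \<Longrightarrow> a \<notin> params_fm C \<Longrightarrow>
    fresh_in a (\<Delta>2 - {(n, Eq (Par a) t)}) \<Longrightarrow>
    deduction ar (EqIG D1 a n D2) (\<Delta>1 \<union> (\<Delta>2 - {(n, Eq (Par a) t)})) C"

definition deduction_from ::
  "('r \<Rightarrow> nat) \<Rightarrow> ('c, 'r) tree \<Rightarrow> ('c, 'r) fm set \<Rightarrow> ('c, 'r) fm \<Rightarrow> bool" where
  "deduction_from ar D \<Gamma> A \<longleftrightarrow> (\<exists>\<Delta>. deduction ar D \<Delta> A \<and> snd ` \<Delta> \<subseteq> \<Gamma>)"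

fun atomic_inst :: "('c, 'r) tree \<Rightarrow> bool" where
  "atomic_inst (Assm n A) \<longleftrightarrow> True"
| "atomic_inst (AndI D1 D2) \<longleftrightarrow> atomic_inst D1 \<and> atomic_inst D2"
| "atomic_inst (AndE1 D) \<longleftrightarrow> atomic_inst D"
| "atomic_inst (AndE2 D) \<longleftrightarrow> atomic_inst D"
| "atomic_inst (ImpI n A D) \<longleftrightarrow> atomic_inst D"
| "atomic_inst (ImpE D1 D2) \<longleftrightarrow> atomic_inst D1 \<and> atomic_inst D2"
| "atomic_inst (OrI1 B D) \<longleftrightarrow> atomic_inst D"
| "atomic_inst (OrI2 A D) \<longleftrightarrow> atomic_inst D"
| "atomic_inst (OrE D n1 D1 n2 D2) \<longleftrightarrow> atomic_inst D \<and> atomic_inst D1 \<and> atomic_inst D2"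
| "atomic_inst (BotE B D) \<longleftrightarrow> atomic_inst D"
| "atomic_inst (ForallI x A a n D) \<longleftrightarrow> atomic_inst D"
| "atomic_inst (ForallE t D1 D2) \<longleftrightarrow> is_atomic t \<and> atomic_inst D1 \<and> atomic_inst D2"
| "atomic_inst (ExistsI x A t D1 D2) \<longleftrightarrow> is_atomic t \<and> atomic_inst D1 \<and> atomic_inst D2"
| "atomic_inst (ExistsE D1 a n m D2) \<longleftrightarrow> atomic_inst D1 \<and> atomic_inst D2"
| "atomic_inst (EqI D) \<longleftrightarrow> atomic_inst D"
| "atomic_inst (EqE x A D1 D2) \<longleftrightarrow> atomic_inst D1 \<and> atomic_inst D2"
| "atomic_inst (AD_Pred i D) \<longleftrightarrow> atomic_inst D"
| "atomic_inst (AD_Eq1 D) \<longleftrightarrow> atomic_inst D"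
| "atomic_inst (AD_Eq2 D) \<longleftrightarrow> atomic_inst D"
| "atomic_inst (IotaI x F a D0 n D1 m k D2) \<longleftrightarrow>
    atomic_inst D0 \<and> atomic_inst D1 \<and> atomic_inst D2"
| "atomic_inst (IotaE1 D1 D2) \<longleftrightarrow> atomic_inst D1 \<and> atomic_inst D2"
| "atomic_inst (IotaE2 D1 D2 D3) \<longleftrightarrow> atomic_inst D1 \<and> atomic_inst D2 \<and> atomic_inst D3"
| "atomic_inst (IotaE3 D) \<longleftrightarrow> atomic_inst D"
| "atomic_inst (EqIG D1 a n D2) \<longleftrightarrow> atomic_inst D1 \<and> atomic_inst D2"

end

(* An instantiation with a complex term t is traced back to one with a parameter: assume a = t for
   a fresh a, to be discharged by the rule EqIG. Then AD gives Existent a, the quantifier rule is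
   applied with a, and =E passes between the instances for a and for t. Since a is fresh, the
   discharge of a = t removes nothing else, so the open assumptions remain exactly the same. *)
theory Submission
  imports Defs
begin

lemma wf_mono:
  fixes t :: "('c, 'r) tm" and A :: "('c, 'r) fm"
  shows "wf_tm ar V t \<Longrightarrow> V \<subseteq> W \<Longrightarrow> wf_tm ar W t"
    and "wf_fm ar V A \<Longrightarrow> V \<subseteq> W \<Longrightarrow> wf_fm ar W A"
proof (induction t and A arbitrary: V W and V W)
  case (Iota x F)
  then show ?case by (metis insert_mono wf_tm.simps(4))
next
  case (Exists x A)
  then show ?case by (metis insert_mono wf_fm.simps(8))
next
  case (Forall x A)
  then show ?case by (metis insert_mono wf_fm.simps(9))
qed auto

text \<open>Since \<open>u\<close> is closed, it remains well-formed under whatever binders it is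
  placed, by \<open>wf_mono\<close>. This lets well-formedness pass between two instances of the
  same formula, as \<open>=E\<close> requires.\<close>

lemma wf_subst_iff:
  assumes u: "wf_tm ar {} u"
  shows "wf_tm ar V (subst_tm x u t) \<longleftrightarrow> wf_tm ar (insert x V) t"
    and "wf_fm ar V (subst_fm x u A) \<longleftrightarrow> wf_fm ar (insert x V) A"
proof (induction t and A arbitrary: V and V)
  case (Var y)
  then show ?case using wf_mono(1)[OF u] by auto
qed (auto simp: insert_commute)

text \<open>This direction asks nothing of \<open>u\<close>: the only variable that substitution
  removes is \<open>x\<close>, which the larger set admits. It recovers the well-formedness of a
  bound body from that of an instance.\<close>

lemma wf_of_wf_subst:
  shows "wf_tm ar V (subst_tm x u t) \<Longrightarrow> wf_tm ar (insert x V) t"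
    and "wf_fm ar V (subst_fm x u A) \<Longrightarrow> wf_fm ar (insert x V) A"
proof (induction t and A arbitrary: V and V)
  case (Var y)
  then show ?case by (auto split: if_splits)
qed (fastforce simp: insert_commute split: if_splits)+

text \<open>Assuming a = t requires t to be well-formed; this is read off from the deduction of
  \<open>Existent t\<close>.\<close>

lemma deduction_is_formula: "deduction ar D \<Delta> A \<Longrightarrow> is_formula ar A"
proof (induction rule: deduction.induct)
  case (ForallI D \<Delta> x a A n)
  then show ?case by (auto dest: wf_of_wf_subst(2))
next
  case (ExistsI D1 \<Delta>1 x t A D2 \<Delta>2)
  then show ?case by (auto dest: wf_of_wf_subst(2))
next
  case (EqE D1 \<Delta>1 t1 t2 D2 \<Delta>2 x A)
  then show ?case by (simp add: wf_subst_iff)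
next
  case (IotaI D0 \<Delta>0 t D1 \<Delta>1 x a F D2 \<Delta>2 n m k)
  then show ?case by (auto dest: wf_of_wf_subst(2))
qed (auto simp: wf_subst_iff)

lemma finite_params:
  fixes t :: "('c, 'r) tm" and A :: "('c, 'r) fm"
  shows "finite (params_tm t)" and "finite (params_fm A)"
  by (induction t and A) auto

lemma finite_open_assumptions: "deduction ar D \<Delta> A \<Longrightarrow> finite \<Delta>"
  by (induction rule: deduction.induct) auto

text \<open>Parameters are natural numbers, and finitely many assumption classes mention only
  finitely many of them.\<close>

lemma ex_fresh_par:
  assumes "finite \<Delta>"
  obtains a where "fresh_in a \<Delta>" "a \<notin> params_tm t" "a \<notin> params_fm A"
proof -
  let ?P = "(\<Union>c\<in>\<Delta>. params_fm (snd c)) \<union> params_tm t \<union> params_fm A"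
  have "finite ?P"
    by (intro finite_UnI finite_UN_I assms finite_params)
  then obtain a where "a \<notin> ?P"
    using ex_new_if_finite[OF infinite_UNIV_nat] by metis
  then have "\<forall>c\<in>\<Delta>. a \<notin> params_fm (snd c)" "a \<notin> params_tm t" "a \<notin> params_fm A"
    by simp_all
  then show ?thesis by (intro that[of a]) (simp_all add: fresh_in_def case_prod_beta)
qed

text \<open>The label \<open>n\<close> may already be in use in \<open>\<Delta>2\<close>: the
  formula a = t contains the fresh \<open>a\<close>, so its class is still not in
  \<open>\<Delta>2\<close>.\<close>

lemma EqIG_fresh:
  assumes "deduction ar D1 \<Delta>1 (Existent t)"
    and "deduction ar D2 (insert (n, Eq (Par a) t) \<Delta>2) C"
    and "fresh_in a \<Delta>2" "a \<notin> params_tm t" "a \<notin> params_fm C"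
  shows "deduction ar (EqIG D1 a n D2) (\<Delta>1 \<union> \<Delta>2) C"
proof -
  have *: "insert (n, Eq (Par a) t) \<Delta>2 - {(n, Eq (Par a) t)} = \<Delta>2"
    using assms(3) by (auto simp: fresh_in_def)
  show ?thesis
    using deduction.EqIG[OF assms(1,2,4,5), of n] assms(3) by (simp add: *)
qed

lemma ForallE_atomic:
  assumes D1: "deduction ar D1 \<Delta>1 (Forall x A)" "atomic_inst D1"
    and D2: "deduction ar D2 \<Delta>2 (Existent t)" "atomic_inst D2"
  shows "\<exists>D. deduction ar D (\<Delta>1 \<union> \<Delta>2) (subst_fm x t A) \<and> atomic_inst D"
proof -
  obtain a where a: "fresh_in a \<Delta>1" "a \<notin> params_tm t" "a \<notin> params_fm (subst_fm x t A)"
    using ex_fresh_par[OF finite_open_assumptions[OF D1(1)]] .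
  \<comment> \<open>Every use of \<open>?E\<close> has the same label and formula, hence belongs to
    one class, discharged by a single application of \<open>EqIG\<close>.\<close>
  let ?E = "Assm 0 (Eq (Par a) t) :: ('b, 'a) tree"
  have E: "deduction ar ?E {(0, Eq (Par a) t)} (Eq (Par a) t)"
    using deduction_is_formula[OF D2(1)] by (auto intro: deduction.Assm)
  let ?D = "EqE x A ?E (ForallE (Par a) D1 (AD_Eq1 ?E))"
  have "deduction ar ?D (insert (0, Eq (Par a) t) \<Delta>1) (subst_fm x t A)"
    using deduction.EqE[OF E deduction.ForallE[OF D1(1) deduction.AD_Eq1[OF E]]]
    by simp
  from EqIG_fresh[OF D2(1) this a]
  have "deduction ar (EqIG D2 a 0 ?D) (\<Delta>1 \<union> \<Delta>2) (subst_fm x t A)"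
    by (simp add: Un_commute)
  moreover have "atomic_inst (EqIG D2 a 0 ?D)"
    using D1(2) D2(2) by simp
  ultimately show ?thesis by blast
qed

text \<open>In contrast to \<open>ForallE_atomic\<close>, the given instance is the one for t and
  has to be turned into the one for a, so the equation is needed in the form t = a.\<close>

lemma ExistsI_atomic:
  assumes D1: "deduction ar D1 \<Delta>1 (subst_fm x t A)" "atomic_inst D1"
    and D2: "deduction ar D2 \<Delta>2 (Existent t)" "atomic_inst D2"
  shows "\<exists>D. deduction ar D (\<Delta>1 \<union> \<Delta>2) (Exists x A) \<and> atomic_inst D"
proof -
  obtain a where a: "fresh_in a \<Delta>1" "a \<notin> params_tm t" "a \<notin> params_fm (Exists x A)"
    using ex_fresh_par[OF finite_open_assumptions[OF D1(1)]] .
  let ?E = "Assm 0 (Eq (Par a) t) :: ('b, 'a) tree"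
  have E: "deduction ar ?E {(0, Eq (Par a) t)} (Eq (Par a) t)"
    using deduction_is_formula[OF D2(1)] by (auto intro: deduction.Assm)
  \<comment> \<open>Symmetry: variable 0 marks the left side of a = a, and rewriting it along a = t
    gives t = a.\<close>
  let ?S = "EqE 0 (Eq (Var 0) (Par a)) ?E (EqI (AD_Eq1 ?E))"
  have refl: "deduction ar (EqI (AD_Eq1 ?E)) {(0, Eq (Par a) t)}
      (subst_fm 0 (Par a) (Eq (Var 0) (Par a)))"
    using deduction.EqI[OF deduction.AD_Eq1[OF E]] by simp
  have sym: "deduction ar ?S {(0, Eq (Par a) t)} (Eq t (Par a))"
    using deduction.EqE[OF E refl] by simp
  let ?D = "ExistsI x A (Par a) (EqE x A ?S D1) (AD_Eq1 ?E)"
  have "deduction ar ?D (insert (0, Eq (Par a) t) \<Delta>1) (Exists x A)"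
    using deduction.ExistsI[OF deduction.EqE[OF sym D1(1)] deduction.AD_Eq1[OF E]] by simp
  from EqIG_fresh[OF D2(1) this a]
  have "deduction ar (EqIG D2 a 0 ?D) (\<Delta>1 \<union> \<Delta>2) (Exists x A)"
    by (simp add: Un_commute)
  moreover have "atomic_inst (EqIG D2 a 0 ?D)"
    using D1(2) D2(2) by simp
  ultimately show ?thesis by blast
qed

text \<open>Keeping \<open>\<Delta>\<close> exactly, labels included, is what makes the induction
  work: discharges and freshness conditions of the later rules carry over unchanged.\<close>

lemma deduction_atomic_inst:
  "deduction ar D \<Delta> A \<Longrightarrow> \<exists>D'. deduction ar D' \<Delta> A \<and> atomic_inst D'"
proof (induction rule: deduction.induct)
  case (ForallE D1 \<Delta>1 x A D2 \<Delta>2 t)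
  then show ?case by (elim exE conjE) (rule ForallE_atomic)
next
  case (ExistsI D1 \<Delta>1 x t A D2 \<Delta>2)
  then show ?case by (elim exE conjE) (rule ExistsI_atomic)
next
  case Assm
  then show ?case using deduction.Assm atomic_inst.simps(1) by fast
next
  \<comment> \<open>From here on, each rule is simply reapplied to the deductions given by the
    induction hypotheses.\<close>
  case AndI
  then show ?case by (elim exE conjE, intro exI conjI) ((rule deduction.AndI; assumption), simp)
next
  case AndE1
  then show ?case by (elim exE conjE, intro exI conjI) ((rule deduction.AndE1; assumption), simp)
next
  case AndE2
  then show ?case by (elim exE conjE, intro exI conjI) ((rule deduction.AndE2; assumption), simp)
next
  case ImpI
  then show ?case by (elim exE conjE, intro exI conjI) ((rule deduction.ImpI; assumption), simp)
next
  case ImpE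
  then show ?case by (elim exE conjE, intro exI conjI) ((rule deduction.ImpE; assumption), simp)
next
  case OrI1
  then show ?case by (elim exE conjE, intro exI conjI) ((rule deduction.OrI1; assumption), simp)
next
  case OrI2
  then show ?case by (elim exE conjE, intro exI conjI) ((rule deduction.OrI2; assumption), simp)
next
  case OrE
  then show ?case by (elim exE conjE, intro exI conjI) ((rule deduction.OrE; assumption), simp)
next
  case BotE
  then show ?case by (elim exE conjE, intro exI conjI) ((rule deduction.BotE; assumption), simp)
next
  case ForallI
  then show ?case by (elim exE conjE, intro exI conjI) ((rule deduction.ForallI; assumption), simp)
next
  case ExistsE
  then show ?case by (elim exE conjE, intro exI conjI) ((rule deduction.ExistsE; assumption), simp)
next
  case EqI
  then show ?case by (elim exE conjE, intro exI conjI) ((rule deduction.EqI; assumption), simp)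
next
  case EqE
  then show ?case by (elim exE conjE, intro exI conjI) ((rule deduction.EqE; assumption), simp)
next
  case AD_Pred
  then show ?case by (elim exE conjE, intro exI conjI) ((rule deduction.AD_Pred; assumption), simp)
next
  case AD_Eq1
  then show ?case by (elim exE conjE, intro exI conjI) ((rule deduction.AD_Eq1; assumption), simp)
next
  case AD_Eq2
  then show ?case by (elim exE conjE, intro exI conjI) ((rule deduction.AD_Eq2; assumption), simp)
next
  case IotaI
  then show ?case by (elim exE conjE, intro exI conjI) ((rule deduction.IotaI; assumption), simp)
next
  case IotaE1
  then show ?case by (elim exE conjE, intro exI conjI) ((rule deduction.IotaE1; assumption), simp)
next
  case IotaE2
  then show ?case by (elim exE conjE, intro exI conjI) ((rule deduction.IotaE2; assumption), simp)
next
  case IotaE3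
  then show ?case by (elim exE conjE, intro exI conjI) ((rule deduction.IotaE3; assumption), simp)
next
  case EqIG
  then show ?case by (elim exE conjE, intro exI conjI) ((rule deduction.EqIG; assumption), simp)
qed

theorem lemma7:
  fixes ar :: "'r \<Rightarrow> nat" and \<Gamma> :: "('c, 'r) fm set" and A :: "('c, 'r) fm"
  assumes "\<exists>D. deduction_from ar D \<Gamma> A"
  shows "\<exists>D. deduction_from ar D \<Gamma> A \<and> atomic_inst D"
proof -
  obtain D \<Delta> where D: "deduction ar D \<Delta> A" and \<Delta>: "snd ` \<Delta> \<subseteq> \<Gamma>"
    using assms unfolding deduction_from_def by (elim exE conjE)
  obtain D' where "deduction ar D' \<Delta> A" "atomic_inst D'"
    using deduction_atomic_inst[OF D] by (elim exE conjE)
  then show ?thesis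
    using \<Delta> unfolding deduction_from_def by (intro exI conjI)
qed

end
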